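(* Let $\gamma$ be a primal optimizer for $\mathrm{OT}(\mu,\nu,c)$, and let $V_1,\ldots,V_N$ be the connected components of the graph $G^\gamma$, with $V_n=X_n\cup Y_n$ for subsets $X_n\subseteq\mathcal{X}$ and $Y_n\subseteq\mathcal{Y}$, for $n\in\{1,\ldots,N\}$. Let $(\varphi_n,\psi_n)$ be the unique (up to translation) optimizer for $\mathrm{DOT}_{X_n,Y_n}(\mu,\nu,c)$ for $n\in\{1,\ldots,N\}$. Then a pair $(\varphi,\psi)$ is an optimizer for $\mathrm{DOT}(\mu,\nu,c)$ if and only if there are constants $\alpha_1,\alpha_2,\ldots,\alpha_N\in\mathbb{R}$ such that: (i) for all $x\in X_n$, we have $\varphi(x)=\varphi_n(x)+\alpha_n+\alpha_1$ if $n\neq 1$, and $\varphi(x)=\varphi_1(x)+\alpha_1$ if $n=1$; (ii) for all $y\in Y_n$, we have $\psi(y)=\psi_n(y)-\alpha_n-\alpha_1$ if $n\neq 1$, and $\psi(y)=\psi_1(y)-\alpha_1$ if $n=1$; (iii) for all $n,m\in\{1,\ldots,N\}$ with $n\neq m$, we have $$-\min_{x\in X_m,\,y\in Y_n}\big(c(x,y)-\varphi_m(x)-\psi_n(y)\big)\;\le\;\alpha_n-\alpha_m\;\le\;\min_{x\in X_n,\,y\in Y_m}\big(c(x,y)-\varphi_n(x)-\psi_m(y)\big).$$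
   Context: $\mu,\nu$ are probability measures on $\mathbb{R}^d$ with finite supports $\mathcal{X}$, $\mathcal{Y}$ respectively (so every point of $\mathcal{X}$, resp. $\mathcal{Y}$, has positive mass), and $c:\mathcal{X}\times\mathcal{Y}\to[0,\infty)$. $\Pi(\mu,\nu)$ is the set of probability measures on $\mathcal{X}\times\mathcal{Y}$ with marginals $\mu$ and $\nu$. $\mathrm{OT}(\mu,\nu,c)=\inf_{\gamma\in\Pi(\mu,\nu)}\int c\,d\gamma$; a minimizer is called a primal optimizer. A pair $(\varphi,\psi)$, $\varphi:\mathcal{X}\to\mathbb{R}$, $\psi:\mathcal{Y}\to\mathbb{R}$, is feasible if $\varphi(x)+\psi(y)\le c(x,y)$ for all $x\in\mathcal{X},y\in\mathcal{Y}$. $\mathrm{DOT}(\mu,\nu,c)$ is the problem of maximizing $\int\varphi\,d\mu+\int\psi\,d\nu$ over feasible pairs; a maximizer is called an optimizer for $\mathrm{DOT}(\mu,\nu,c)$ (dual optimizer). "Unique up to translation" means unique up to replacing $(\varphi,\psi)$ by $(\varphi+a,\psi-a)$, $a\in\mathbb{R}$; $(\varphi_n,\psi_n)$ denotes a fixed representative. For a primal optimizer $\gamma$, $G^\gamma$ is the bipartite graph with vertex classes $\mathcal{X}$ and $\mathcal{Y}$ (elements of $\mathcal{X}$ and of $\mathcal{Y}$ are regarded as distinct vertices), in which $x\in\mathcal{X}$ and $y\in\mathcal{Y}$ are joined by an edge $[x,y]$ iff $\gamma(x,y)>0$. For $X\subseteq\mathcal{X}$, $Y\subseteq\mathcal{Y}$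 with $\mu(X)=\nu(Y)>0$ (which holds for $X_n,Y_n$ above), $\mathrm{OT}_{X,Y}(\mu,\nu,c):=\mathrm{OT}\big(\tfrac1{\mu(X)}\mu|_X,\tfrac1{\nu(Y)}\nu|_Y,c|_{X\times Y}\big)$ and $\mathrm{DOT}_{X,Y}(\mu,\nu,c)$ is its dual problem.
   Formalization: In (iii), α_1 is replaced by 0 whenever n or m equals 1 (α_n is kept for n≠1), because as stated (iii) fails under translating (φ,ψ) by a constant when N≥2; (i) and (ii) are unchanged. *)

theory Defs
  imports "HOL-Probability.Probability" "Graph_Theory.Digraph_Component" "Graph_Theory.Pair_Digraph"
begin

text \<open>
  A finitely supported probability measure is a \<^typ>\<open>'a pmf\<close> whose support
  \<^term>\<open>set_pmf p\<close> (the points of positive mass) is finite.  Costs and potentials are total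
  functions; only their values on the supports are ever used.
\<close>

definition couplings :: "'a pmf \<Rightarrow> 'b pmf \<Rightarrow> ('a \<times> 'b) pmf set" where
  "couplings \<mu> \<nu> = {\<gamma>. map_pmf fst \<gamma> = \<mu> \<and> map_pmf snd \<gamma> = \<nu>}"

definition transport_cost :: "('a \<Rightarrow> 'b \<Rightarrow> real) \<Rightarrow> ('a \<times> 'b) pmf \<Rightarrow> real" where
  "transport_cost c \<gamma> = measure_pmf.expectation \<gamma> (\<lambda>(x, y). c x y)"

definition OT :: "'a pmf \<Rightarrow> 'b pmf \<Rightarrow> ('a \<Rightarrow> 'b \<Rightarrow> real) \<Rightarrow> real" where
  "OT \<mu> \<nu> c = (INF \<gamma>\<in>couplings \<mu> \<nu>. transport_cost c \<gamma>)"

definition primal_optimizer ::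
    "'a pmf \<Rightarrow> 'b pmf \<Rightarrow> ('a \<Rightarrow> 'b \<Rightarrow> real) \<Rightarrow> ('a \<times> 'b) pmf \<Rightarrow> bool" where
  "primal_optimizer \<mu> \<nu> c \<gamma> \<longleftrightarrow> \<gamma> \<in> couplings \<mu> \<nu> \<and> transport_cost c \<gamma> = OT \<mu> \<nu> c"

definition feasible ::
    "'a pmf \<Rightarrow> 'b pmf \<Rightarrow> ('a \<Rightarrow> 'b \<Rightarrow> real) \<Rightarrow> ('a \<Rightarrow> real) \<Rightarrow> ('b \<Rightarrow> real) \<Rightarrow> bool" where
  "feasible \<mu> \<nu> c \<phi> \<psi> \<longleftrightarrow> (\<forall>x\<in>set_pmf \<mu>. \<forall>y\<in>set_pmf \<nu>. \<phi> x + \<psi> y \<le> c x y)"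

definition dual_value :: "'a pmf \<Rightarrow> 'b pmf \<Rightarrow> ('a \<Rightarrow> real) \<Rightarrow> ('b \<Rightarrow> real) \<Rightarrow> real" where
  "dual_value \<mu> \<nu> \<phi> \<psi> = measure_pmf.expectation \<mu> \<phi> + measure_pmf.expectation \<nu> \<psi>"

definition dual_optimizer ::
    "'a pmf \<Rightarrow> 'b pmf \<Rightarrow> ('a \<Rightarrow> 'b \<Rightarrow> real) \<Rightarrow> ('a \<Rightarrow> real) \<Rightarrow> ('b \<Rightarrow> real) \<Rightarrow> bool" where
  "dual_optimizer \<mu> \<nu> c \<phi> \<psi> \<longleftrightarrow>
     feasible \<mu> \<nu> c \<phi> \<psi> \<and>
     (\<forall>\<phi>' \<psi>'. feasible \<mu> \<nu> c \<phi>' \<psi>' \<longrightarrow> dual_value \<mu> \<nu> \<phi>' \<psi>' \<le> dual_value \<mu> \<nu> \<phi> \<psi>)"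

text \<open>
  \<^term>\<open>cond_pmf \<mu> X\<close> is the normalised restriction of \<open>\<mu>\<close> to \<open>X\<close>; its support is
  \<open>set_pmf \<mu> \<inter> X\<close>.  It is meaningful when \<open>X\<close> has positive mass.
\<close>

definition restricted_dual_optimizer ::
    "'a set \<Rightarrow> 'b set \<Rightarrow> 'a pmf \<Rightarrow> 'b pmf \<Rightarrow> ('a \<Rightarrow> 'b \<Rightarrow> real) \<Rightarrow>
     ('a \<Rightarrow> real) \<Rightarrow> ('b \<Rightarrow> real) \<Rightarrow> bool" where
  "restricted_dual_optimizer X Y \<mu> \<nu> c \<phi> \<psi> \<longleftrightarrow>
     dual_optimizer (cond_pmf \<mu> X) (cond_pmf \<nu> Y) c \<phi> \<psi>"

text \<open>
  The undirected bipartite graph of a coupling is encoded, as usual in the graph library, as a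
  symmetric digraph.  The sum type keeps the two vertex classes disjoint.  The connected components
  of an undirected graph are the strongly connected components of its symmetric digraph.
\<close>

definition coupling_graph ::
    "'a pmf \<Rightarrow> 'b pmf \<Rightarrow> ('a \<times> 'b) pmf \<Rightarrow> ('a + 'b) pair_pre_digraph" where
  "coupling_graph \<mu> \<nu> \<gamma> =
     \<lparr> pverts = set_pmf \<mu> <+> set_pmf \<nu>,
       parcs = {(Inl x, Inr y) | x y. x \<in> set_pmf \<mu> \<and> y \<in> set_pmf \<nu> \<and> pmf \<gamma> (x, y) > 0} \<union>
               {(Inr y, Inl x) | x y. x \<in> set_pmf \<mu> \<and> y \<in> set_pmf \<nu> \<and> pmf \<gamma> (x, y) > 0} \<rparr>"

definition graph_components :: "'v pair_pre_digraph \<Rightarrow> 'v set set" where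
  "graph_components G = pre_digraph.sccs_verts (with_proj G)"

text \<open>
  The potentials on the \<open>n\<close>-th component are shifted by \<open>\<alpha> 1\<close> (common to all components) plus a
  shift relative to the first component, which is \<open>\<alpha> n\<close> for \<open>n \<noteq> 1\<close> and \<open>0\<close> for \<open>n = 1\<close>.
  The inequalities between two components constrain only these relative shifts.  With \<open>\<alpha> 1\<close> itself
  in place of \<open>0\<close> they would not be invariant under the translation \<open>(\<phi> + a, \<psi> - a)\<close>, which
  preserves dual optimizers and acts on the constants by \<open>\<alpha> 1 \<mapsto> \<alpha> 1 + a\<close>.
\<close>

definition relative_shift :: "(nat \<Rightarrow> real) \<Rightarrow> nat \<Rightarrow> real" where
  "relative_shift \<alpha> n = (if n = 1 then 0 else \<alpha> n)"

end

theory Submission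
  imports Defs
begin

text \<open>
  Since \<open>\<gamma>\<close> is optimal, moving a little mass along a cycle through its support cannot lower the
  cost, so the support is \<open>c\<close>-cyclically monotone and Rockafellar's construction (an infimum over
  chains) gives feasible potentials that are tight on the support.  Their existence makes
  ``feasible and tight on the support'' a characterization of all dual optimizers.  No edge of the
  graph leaves a component, so restricting \<open>\<gamma>\<close> to \<open>X\<^sub>n \<times> Y\<^sub>n\<close> yields a coupling of the restricted
  marginals, and the same potentials give the same characterization for each component problem.

  Two pairs that are tight along the edges of a connected component differ there by a translation
  \<open>\<beta>\<^sub>n\<close>.  Hence the dual optimizers are exactly the pairs \<open>(\<phi>\<^sub>n + \<beta>\<^sub>n, \<psi>\<^sub>n - \<beta>\<^sub>n)\<close> satisfying the remaining
  constraints, those between different components: \<open>\<beta>\<^sub>n - \<beta>\<^sub>m \<le> c x y - \<phi>\<^sub>n x - \<psi>\<^sub>m y\<close> on \<open>X\<^sub>n \<times> Y\<^sub>m\<close>.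
  The constants of the theorem are \<open>\<alpha>\<^sub>1 = \<beta>\<^sub>1\<close> and \<open>\<alpha>\<^sub>n = \<beta>\<^sub>n - \<beta>\<^sub>1\<close>.
\<close>

section \<open>Chains of links and their sums\<close>

text \<open>
  The head of the list is the last link of the chain: for \<open>[(x\<^sub>k, y\<^sub>k), \<dots>, (x\<^sub>1, y\<^sub>1)]\<close> and
  \<open>x = x\<^bsub>k+1\<^esub>\<close> the sum is \<open>\<Sum>i. f x\<^bsub>i+1\<^esub> y\<^sub>i - f x\<^sub>i y\<^sub>i\<close>.  It is a cycle when \<open>x = x\<^sub>1\<close>.
\<close>

fun chain_sum :: "('a \<Rightarrow> 'b \<Rightarrow> real) \<Rightarrow> ('a \<times> 'b) list \<Rightarrow> 'a \<Rightarrow> real" where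
  "chain_sum f [] x = 0"
| "chain_sum f ((x', y) # ps) x = f x y - f x' y + chain_sum f ps x'"

text \<open>The vertex \<open>u\<close> is the first coordinate of the last pair of
  \<open>ps\<close>, or \<open>x\<close> if \<open>ps\<close> is empty. It does not depend on the
  appended pair and ranges over a finite set once the pairs do, which later bounds chain sums from
  below.\<close>

lemma chain_sum_snoc:
  "\<exists>u\<in>insert x (fst ` set ps). \<forall>x' y'.
     chain_sum f (ps @ [(x', y')]) x = chain_sum f ps x + f u y' - f x' y'"
proof (induction ps arbitrary: x)
  case (Cons p ps)
  obtain x1 y1 where p: "p = (x1, y1)" by force
  from Cons[of x1] obtain u where "u \<in> insert x1 (fst ` set ps)"
    "\<forall>x' y'. chain_sum f (ps @ [(x', y')]) x1 = chain_sum f ps x1 + f u y' - f x' y'"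
    by blast
  then show ?case unfolding p by (intro bexI[of _ u]) auto
qed auto

text \<open>The links telescope. For a closed cycle, \<open>x = x'\<close>, the result is 0:
  rerouting preserves the first marginal.\<close>

lemma chain_sum_fst_only: "chain_sum (\<lambda>x y. g x) (ps @ [(x', y')]) x = g x - g x'"
  by (induction ps arbitrary: x) auto

text \<open>Both terms of a link share the same \<open>y\<close> and cancel, so rerouting preserves
  the second marginal and the total mass.\<close>

lemma chain_sum_snd_only: "chain_sum (\<lambda>x y. g y) ps x = 0"
  by (induction ps arbitrary: x) auto

text \<open>
  With the indicator of \<open>p\<close> as \<open>f\<close>, the chain sum is the mass that rerouting along the chain
  adds at \<open>p\<close>.
\<close>

lemma sum_mult_chain_sum_indicator:
  assumes "finite A" "finite B" "x \<in> A" "set ps \<subseteq> A \<times> B"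
  shows "(\<Sum>p\<in>A \<times> B. (f p :: real) * chain_sum (\<lambda>u v. of_bool ((u, v) = p)) ps x)
       = chain_sum (\<lambda>u v. f (u, v)) ps x"
  using assms(3,4)
proof (induction ps arbitrary: x)
  case (Cons q ps)
  obtain x1 y1 where q: "q = (x1, y1)" by force
  have *: "(\<Sum>p\<in>A \<times> B. f p * of_bool ((u, y1) = p)) = f (u, y1)" if "u \<in> A" for u
  proof -
    have "(\<Sum>p\<in>A \<times> B. f p * of_bool ((u, y1) = p)) = (\<Sum>p\<in>A \<times> B. if p = (u, y1) then f p else 0)"
      by (intro sum.cong) auto
    then show ?thesis using that assms Cons.prems q by simp
  qed
  have "(\<Sum>p\<in>A \<times> B. f p * chain_sum (\<lambda>u v. of_bool ((u, v) = p)) (q # ps) x)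
      = (\<Sum>p\<in>A \<times> B. f p * of_bool ((x, y1) = p)) - (\<Sum>p\<in>A \<times> B. f p * of_bool ((x1, y1) = p))
        + (\<Sum>p\<in>A \<times> B. f p * chain_sum (\<lambda>u v. of_bool ((u, v) = p)) ps x1)"
    unfolding q by (simp only: chain_sum.simps distrib_left right_diff_distrib sum.distrib sum_subtractf)
  also have "\<dots> = chain_sum (\<lambda>u v. f (u, v)) (q # ps) x"
    using Cons q *[of x] *[of x1] by simp
  finally show ?case .
qed simp

lemma chain_sum_indicator_lower:
  "- real (length ps) \<le> chain_sum (\<lambda>u v. of_bool ((u, v) = p)) ps x"
proof (induction ps arbitrary: x)
  case (Cons q ps)
  obtain x1 y1 where "q = (x1, y1)" by force
  then show ?case using Cons[of x1] by (auto simp: of_bool_def)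
qed simp

lemma chain_sum_indicator_nonneg:
  "p \<notin> set ps \<Longrightarrow> 0 \<le> chain_sum (\<lambda>u v. of_bool ((u, v) = p)) ps x"
  by (induction ps arbitrary: x) auto

section \<open>Optimal couplings have cyclically monotone support\<close>

lemma set_pmf_coupling:
  assumes "\<gamma> \<in> couplings \<mu> \<nu>"
  shows "set_pmf \<gamma> \<subseteq> set_pmf \<mu> \<times> set_pmf \<nu>"
    and "x \<in> set_pmf \<mu> \<Longrightarrow> \<exists>y. (x, y) \<in> set_pmf \<gamma>"
    and "y \<in> set_pmf \<nu> \<Longrightarrow> \<exists>x. (x, y) \<in> set_pmf \<gamma>"
  using assms by (force simp: couplings_def)+

text \<open>A real infimum is a lower bound only for a set bounded below; nonnegative costs provide
  the bound 0.\<close>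

lemma OT_le_transport_cost:
  assumes "\<And>x y. x \<in> set_pmf \<mu> \<Longrightarrow> y \<in> set_pmf \<nu> \<Longrightarrow> 0 \<le> c x y" and "\<gamma> \<in> couplings \<mu> \<nu>"
  shows "OT \<mu> \<nu> c \<le> transport_cost c \<gamma>"
  unfolding OT_def
proof (rule cINF_lower[OF _ assms(2)])
  show "bdd_below (transport_cost c ` couplings \<mu> \<nu>)"
  proof (rule bdd_belowI2)
    fix \<gamma>' assume "\<gamma>' \<in> couplings \<mu> \<nu>"
    then show "0 \<le> transport_cost c \<gamma>'"
      unfolding transport_cost_def using assms(1) set_pmf_coupling(1)[of \<gamma>' \<mu> \<nu>]
      by (intro integral_nonneg_AE) (auto simp: AE_measure_pmf_iff)
  qed
qed

text \<open>Marginals are compared on fibres of the projections, whose probabilities are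
  expectations of indicators and hence accessible to a formula for expectations.\<close>

lemma couplings_eqI:
  assumes "\<gamma> \<in> couplings \<mu> \<nu>"
    and "\<And>a. measure_pmf.prob \<gamma>' (fst -` {a}) = measure_pmf.prob \<gamma> (fst -` {a})"
    and "\<And>b. measure_pmf.prob \<gamma>' (snd -` {b}) = measure_pmf.prob \<gamma> (snd -` {b})"
  shows "\<gamma>' \<in> couplings \<mu> \<nu>"
proof -
  have "map_pmf fst \<gamma>' = map_pmf fst \<gamma>" "map_pmf snd \<gamma>' = map_pmf snd \<gamma>"
    by (intro pmf_eqI; simp add: pmf_map assms)+
  then show ?thesis using assms(1) by (simp add: couplings_def)
qed

lemma primal_optimizer_cyclically_monotone:
  fixes \<mu> :: "'a pmf" and \<nu> :: "'b pmf"
  assumes fin: "finite (set_pmf \<mu>)" "finite (set_pmf \<nu>)"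
    and c: "\<And>x y. x \<in> set_pmf \<mu> \<Longrightarrow> y \<in> set_pmf \<nu> \<Longrightarrow> 0 \<le> c x y"
    and opt: "primal_optimizer \<mu> \<nu> c \<gamma>"
    and ps: "set ps \<subseteq> set_pmf \<gamma>" and xy: "(x, y) \<in> set_pmf \<gamma>"
  shows "0 \<le> chain_sum c (ps @ [(x, y)]) x"
proof -
  define qs where "qs = ps @ [(x, y)]"
  define A where "A = set_pmf \<mu> \<times> set_pmf \<nu>"
  define \<delta> where "\<delta> p = chain_sum (\<lambda>u v. of_bool ((u, v) = p)) qs x" for p
  \<comment> \<open>The smallest mass on the cycle, shared among its links: each link takes at most
    \<epsilon> from a pair, so even a pair used by every link keeps nonnegative mass.\<close>
  define \<epsilon> where "\<epsilon> = Min (pmf \<gamma> ` set qs) / real (length qs)"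
  define w where "w p = (if p \<in> A then pmf \<gamma> p + \<epsilon> * \<delta> p else 0)" for p
  have \<gamma>: "\<gamma> \<in> couplings \<mu> \<nu>" using opt by (simp add: primal_optimizer_def)
  note supp = set_pmf_coupling(1)[OF \<gamma>]
  have finA: "finite A" using fin by (simp add: A_def)
  have qs: "set qs \<subseteq> set_pmf \<gamma>" "set qs \<noteq> {}" "length qs > 0" using ps xy by (auto simp: qs_def)
  have sum_\<delta>: "(\<Sum>p\<in>A. f p * \<delta> p) = chain_sum (\<lambda>u v. f (u, v)) qs x" for f
    unfolding A_def \<delta>_def by (rule sum_mult_chain_sum_indicator) (use fin supp xy qs in auto)
  have "Min (pmf \<gamma> ` set qs) > 0" using qs by (auto simp: pmf_positive)
  then have \<epsilon>: "\<epsilon> > 0" using qs by (simp add: \<epsilon>_def)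
  have w_nonneg: "0 \<le> w p" for p
  proof (cases "p \<in> set qs")
    case True
    have "- pmf \<gamma> p \<le> - Min (pmf \<gamma> ` set qs)" using True by simp
    also have "\<dots> = \<epsilon> * - real (length qs)" using qs by (simp add: \<epsilon>_def)
    also have "\<dots> \<le> \<epsilon> * \<delta> p"
      unfolding \<delta>_def using \<epsilon> by (intro mult_left_mono chain_sum_indicator_lower) simp
    finally show ?thesis by (simp add: w_def)
  next
    case False
    then show ?thesis using \<epsilon> chain_sum_indicator_nonneg[of p qs x] by (simp add: w_def \<delta>_def)
  qed
  have sum_w: "(\<Sum>p\<in>A. f p * w p) = measure_pmf.expectation \<gamma> f + \<epsilon> * chain_sum (\<lambda>u v. f (u, v)) qs x"
    for f :: "'a \<times> 'b \<Rightarrow> real"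
  proof -
    have "(\<Sum>p\<in>A. f p * w p) = (\<Sum>p\<in>A. f p * pmf \<gamma> p) + \<epsilon> * (\<Sum>p\<in>A. f p * \<delta> p)"
      by (simp add: w_def algebra_simps sum.distrib sum_distrib_left)
    also have "(\<Sum>p\<in>A. f p * pmf \<gamma> p) = measure_pmf.expectation \<gamma> f"
      by (rule integral_measure_pmf_real[symmetric]) (use finA supp A_def in auto)
    finally show ?thesis by (simp add: sum_\<delta>)
  qed
  have "sum w A = 1"
    using sum_w[of "\<lambda>_. 1"] chain_sum_snd_only[of "\<lambda>_. 1" qs x] by simp
  moreover have "w p = 0" if "p \<notin> A" for p using that by (simp add: w_def)
  ultimately have "(\<integral>\<^sup>+p. ennreal (w p) \<partial>count_space UNIV) = 1"
    using w_nonneg finA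
    by (subst nn_integral_count_space'[of A]) simp_all
  then have "\<exists>\<gamma>'. \<forall>p. pmf \<gamma>' p = w p"
    using w_nonneg by (intro exI[of _ "embed_pmf w"] allI pmf_embed_pmf)
  then obtain \<gamma>' where pmf': "\<And>p. pmf \<gamma>' p = w p" by blast
  have E: "measure_pmf.expectation \<gamma>' f
      = measure_pmf.expectation \<gamma> f + \<epsilon> * chain_sum (\<lambda>u v. f (u, v)) qs x" for f :: "'a \<times> 'b \<Rightarrow> real"
    unfolding sum_w[symmetric] pmf'[symmetric]
    by (rule integral_measure_pmf_real) (use finA pmf' in \<open>auto simp: set_pmf_iff w_def split: if_splits\<close>)
  \<comment> \<open>The indicator of a fibre depends on one coordinate only: for \<open>fst\<close>
    its chain sum telescopes around the closed cycle, for \<open>snd\<close> every link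
    cancels.\<close>
  have "\<gamma>' \<in> couplings \<mu> \<nu>"
  proof (rule couplings_eqI[OF \<gamma>])
    fix a :: 'a
    have "(\<lambda>(u :: 'a) (v :: 'b). indicator (fst -` {a}) (u, v) :: real) = (\<lambda>u v. indicator {a} u)"
      by (auto simp: indicator_def fun_eq_iff)
    then show "measure_pmf.prob \<gamma>' (fst -` {a}) = measure_pmf.prob \<gamma> (fst -` {a})"
      using E[of "indicator (fst -` {a})"] by (simp add: qs_def chain_sum_fst_only)
  next
    fix b :: 'b
    have "(\<lambda>(u :: 'a) (v :: 'b). indicator (snd -` {b}) (u, v) :: real) = (\<lambda>u v. indicator {b} v)"
      by (auto simp: indicator_def fun_eq_iff)
    then show "measure_pmf.prob \<gamma>' (snd -` {b}) = measure_pmf.prob \<gamma> (snd -` {b})"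
      using E[of "indicator (snd -` {b})"] by (simp add: chain_sum_snd_only)
  qed
  then have "transport_cost c \<gamma> \<le> transport_cost c \<gamma>'"
    using OT_le_transport_cost[of \<mu> \<nu> c] c opt by (simp add: primal_optimizer_def)
  then have "0 \<le> \<epsilon> * chain_sum c qs x"
    using E[of "\<lambda>(u, v). c u v"] by (simp add: transport_cost_def)
  then show ?thesis using \<epsilon> by (simp add: qs_def zero_le_mult_iff)
qed

section \<open>Rockafellar potentials\<close>

lemma cyclically_monotone_imp_potentials:
  assumes fin: "finite S"
    and mono: "\<And>ps x y. set ps \<subseteq> S \<Longrightarrow> (x, y) \<in> S \<Longrightarrow> 0 \<le> chain_sum c (ps @ [(x, y)]) x"
  shows "\<exists>\<phi> \<psi>. (\<forall>x\<in>fst ` S. \<forall>y\<in>snd ` S. \<phi> x + \<psi> y \<le> c x y) \<and> (\<forall>(x, y)\<in>S. \<phi> x + \<psi> y = c x y)"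
proof -
  define \<phi> where "\<phi> x = (INF ps\<in>lists S. chain_sum c ps x)" for x
  have bdd: "bdd_below ((\<lambda>ps. chain_sum c ps x) ` lists S)" if "(x, y) \<in> S" for x y
  proof (rule bdd_belowI2)
    fix ps assume ps: "ps \<in> lists S"
    obtain u where u: "u \<in> insert x (fst ` set ps)"
      "\<forall>x' y'. chain_sum c (ps @ [(x', y')]) x = chain_sum c ps x + c u y' - c x' y'"
      using chain_sum_snoc[of x ps c] by blast
    have "c u y \<le> Max ((\<lambda>u. c u y) ` fst ` S)"
      using fin ps u(1) that by (intro Max_ge) force+
    moreover have "0 \<le> chain_sum c ps x + c u y - c x y"
      using mono[of ps x y] ps that u(2) by (auto simp: lists_eq_set)
    ultimately show "c x y - Max ((\<lambda>u. c u y) ` fst ` S) \<le> chain_sum c ps x" by linarith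
  qed
  \<comment> \<open>Prepending \<open>(x, y)\<close> turns a chain ending at \<open>x\<close> into
    one ending at \<open>x'\<close>, and \<phi> at \<open>x'\<close> is an infimum over a set
    containing all of these.\<close>
  have step: "\<phi> x' \<le> \<phi> x + c x' y - c x y" if "(x, y) \<in> S" "x' \<in> fst ` S" for x x' y
  proof -
    have "\<phi> x' - c x' y + c x y \<le> \<phi> x" unfolding \<phi>_def[of x]
    proof (rule cINF_greatest)
      fix ps assume "ps \<in> lists S"
      with that bdd have "\<phi> x' \<le> chain_sum c ((x, y) # ps) x'"
        unfolding \<phi>_def by (intro cINF_lower) auto
      then show "\<phi> x' - c x' y + c x y \<le> chain_sum c ps x" by simp
    qed auto
    then show ?thesis by simp
  qed
  \<comment> \<open>Any partner of \<open>y\<close> gives the same value: \<open>step\<close>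
    applied in both directions between two partners yields equality.\<close>
  define \<psi> where "\<psi> y = (let x = (SOME x. (x, y) \<in> S) in c x y - \<phi> x)" for y
  have \<psi>: "\<psi> y = c x y - \<phi> x" if "(x, y) \<in> S" for x y
  proof -
    have "(SOME x. (x, y) \<in> S, y) \<in> S" using that by (rule someI)
    moreover from calculation have "(SOME x. (x, y) \<in> S) \<in> fst ` S" by (metis fst_conv imageI)
    moreover have "x \<in> fst ` S" using that by force
    ultimately show ?thesis
      using step[OF that] step[of "SOME x. (x, y) \<in> S" y x] unfolding \<psi>_def Let_def by fastforce
  qed
  show ?thesis
  proof (intro exI[of _ \<phi>] exI[of _ \<psi>] conjI ballI)
    fix x' y assume "x' \<in> fst ` S" "y \<in> snd ` S"
    then obtain x where "(x, y) \<in> S" by force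
    then show "\<phi> x' + \<psi> y \<le> c x' y" using step[of x y x'] \<open>x' \<in> fst ` S\<close> \<psi>[of x y] by simp
  qed (auto simp: \<psi>)
qed

lemma primal_optimizer_imp_potentials:
  assumes "finite (set_pmf \<mu>)" "finite (set_pmf \<nu>)"
    and "\<And>x y. x \<in> set_pmf \<mu> \<Longrightarrow> y \<in> set_pmf \<nu> \<Longrightarrow> 0 \<le> c x y"
    and opt: "primal_optimizer \<mu> \<nu> c \<gamma>"
  shows "\<exists>\<phi> \<psi>. feasible \<mu> \<nu> c \<phi> \<psi> \<and> (\<forall>(x, y)\<in>set_pmf \<gamma>. \<phi> x + \<psi> y = c x y)"
proof -
  have \<gamma>: "\<gamma> \<in> couplings \<mu> \<nu>" using opt by (simp add: primal_optimizer_def)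
  have "finite (set_pmf \<gamma>)"
    using set_pmf_coupling(1)[OF \<gamma>] assms(1,2) by (blast intro: finite_subset)
  moreover have "fst ` set_pmf \<gamma> = set_pmf \<mu>" "snd ` set_pmf \<gamma> = set_pmf \<nu>"
    using \<gamma> by (metis (mono_tags, lifting) couplings_def mem_Collect_eq set_map_pmf)+
  ultimately show ?thesis
    using cyclically_monotone_imp_potentials[of "set_pmf \<gamma>" c]
      primal_optimizer_cyclically_monotone[OF assms]
    by (simp add: feasible_def)
qed

section \<open>Complementary slackness\<close>

lemma dual_value_coupling:
  assumes "finite (set_pmf \<gamma>)" "\<gamma> \<in> couplings \<mu> \<nu>"
  shows "dual_value \<mu> \<nu> \<phi> \<psi> = measure_pmf.expectation \<gamma> (\<lambda>(x, y). \<phi> x + \<psi> y)"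
proof -
  have "\<mu> = map_pmf fst \<gamma>" "\<nu> = map_pmf snd \<gamma>" using assms(2) by (auto simp: couplings_def)
  then show ?thesis
    using assms(1)
    by (simp add: dual_value_def case_prod_unfold integrable_measure_pmf_finite)
qed

text \<open>The dual value of a feasible pair is at most the cost of \<gamma>, and the given tight
  pair attains this bound. A feasible pair is thus optimal iff its slack, nonnegative on the
  support, has expectation 0, that is, vanishes there. Asking for a tight pair rather than
  optimality of \<gamma> lets the criterion apply directly to restricted couplings.\<close>

lemma dual_optimizer_iff_tight:
  assumes fin: "finite (set_pmf \<gamma>)" and \<gamma>: "\<gamma> \<in> couplings \<mu> \<nu>"
    and feas0: "feasible \<mu> \<nu> c \<phi>0 \<psi>0" and tight0: "\<forall>(x, y)\<in>set_pmf \<gamma>. \<phi>0 x + \<psi>0 y = c x y"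
  shows "dual_optimizer \<mu> \<nu> c \<phi> \<psi> \<longleftrightarrow>
    feasible \<mu> \<nu> c \<phi> \<psi> \<and> (\<forall>(x, y)\<in>set_pmf \<gamma>. \<phi> x + \<psi> y = c x y)"
proof -
  let ?E = "measure_pmf.expectation \<gamma> :: _ \<Rightarrow> real"
  note int = integrable_measure_pmf_finite[OF fin]
  note dv = dual_value_coupling[OF fin \<gamma>]
  note supp = set_pmf_coupling(1)[OF \<gamma>]
  have le: "dual_value \<mu> \<nu> \<phi>' \<psi>' \<le> ?E (\<lambda>(x, y). c x y)" if "feasible \<mu> \<nu> c \<phi>' \<psi>'" for \<phi>' \<psi>'
    unfolding dv using that supp
    by (intro integral_mono_AE int) (auto simp: AE_measure_pmf_iff feasible_def)
  have eq: "dual_value \<mu> \<nu> \<phi>' \<psi>' = ?E (\<lambda>(x, y). c x y)"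
    if "\<forall>(x, y)\<in>set_pmf \<gamma>. \<phi>' x + \<psi>' y = c x y" for \<phi>' \<psi>'
    unfolding dv using that by (intro integral_cong_AE) (auto simp: AE_measure_pmf_iff)
  show ?thesis
  proof (intro iffI conjI)
    assume opt: "dual_optimizer \<mu> \<nu> c \<phi> \<psi>"
    then show feas: "feasible \<mu> \<nu> c \<phi> \<psi>" by (simp add: dual_optimizer_def)
    have "?E (\<lambda>(x, y). c x y) \<le> dual_value \<mu> \<nu> \<phi> \<psi>"
      using opt feas0 eq[OF tight0] unfolding dual_optimizer_def by metis
    with le[OF feas] have "?E (\<lambda>(x, y). c x y) - ?E (\<lambda>(x, y). \<phi> x + \<psi> y) = 0"
      by (simp add: dv)
    then have "?E (\<lambda>p. (case p of (x, y) \<Rightarrow> c x y) - (case p of (x, y) \<Rightarrow> \<phi> x + \<psi> y)) = 0"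
      by (subst Bochner_Integration.integral_diff[OF int int])
    moreover have "AE p in \<gamma>. 0 \<le> (case p of (x, y) \<Rightarrow> c x y) - (case p of (x, y) \<Rightarrow> \<phi> x + \<psi> y)"
      using feas supp by (auto simp: AE_measure_pmf_iff feasible_def)
    ultimately show "\<forall>(x, y)\<in>set_pmf \<gamma>. \<phi> x + \<psi> y = c x y"
      using integral_nonneg_eq_0_iff_AE[OF int] by (force simp: AE_measure_pmf_iff)
  next
    assume "feasible \<mu> \<nu> c \<phi> \<psi> \<and> (\<forall>(x, y)\<in>set_pmf \<gamma>. \<phi> x + \<psi> y = c x y)"
    then show "dual_optimizer \<mu> \<nu> c \<phi> \<psi>" using le eq by (simp add: dual_optimizer_def)
  qed
qed

section \<open>Restricting couplings\<close>

lemma cond_pmf_cong: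
  assumes "set_pmf p \<inter> A = set_pmf p \<inter> B" "set_pmf p \<inter> A \<noteq> {}"
  shows "cond_pmf p A = cond_pmf p B"
proof (rule pmf_eqI)
  fix x
  have "measure_pmf.prob p A = measure_pmf.prob p B"
    using assms(1) by (metis Int_commute measure_Int_set_pmf)
  moreover have "set_pmf p \<inter> B \<noteq> {}" using assms by simp
  moreover have "x \<in> A \<longleftrightarrow> x \<in> B" if "pmf p x \<noteq> 0"
    using assms(1) that unfolding set_pmf_iff[symmetric] by blast
  ultimately show "pmf (cond_pmf p A) x = pmf (cond_pmf p B) x"
    by (cases "pmf p x = 0") (simp_all add: pmf_cond[of p A, OF assms(2)] pmf_cond[of p B])
qed

text \<open>By \<open>sep\<close>, the rectangle \<open>X \<times> Y\<close> and the preimages of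
  \<open>X\<close> and \<open>Y\<close> under the projections agree on the support of \<gamma>, and
  conditioning on a preimage commutes with taking the image measure.\<close>

lemma cond_pmf_in_couplings:
  assumes \<gamma>: "\<gamma> \<in> couplings \<mu> \<nu>" and ne: "set_pmf \<gamma> \<inter> X \<times> Y \<noteq> {}"
    and sep: "\<forall>(x, y)\<in>set_pmf \<gamma>. x \<in> X \<longleftrightarrow> y \<in> Y"
  shows "cond_pmf \<gamma> (X \<times> Y) \<in> couplings (cond_pmf \<mu> X) (cond_pmf \<nu> Y)"
proof -
  have eqs: "set_pmf \<gamma> \<inter> X \<times> Y = set_pmf \<gamma> \<inter> fst -` X" "set_pmf \<gamma> \<inter> X \<times> Y = set_pmf \<gamma> \<inter> snd -` Y"
    using sep by auto
  have "map_pmf fst (cond_pmf \<gamma> (fst -` X)) = cond_pmf (map_pmf fst \<gamma>) X"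
       "map_pmf snd (cond_pmf \<gamma> (snd -` Y)) = cond_pmf (map_pmf snd \<gamma>) Y"
    by (rule cond_map_pmf[symmetric], use ne eqs in blast)+
  then show ?thesis
    using \<gamma> cond_pmf_cong[OF eqs(1) ne] cond_pmf_cong[OF eqs(2) ne] by (simp add: couplings_def)
qed

section \<open>Connected components of the coupling graph\<close>

lemma reachable_coupling_graph_sym:
  "u \<rightarrow>\<^sup>*\<^bsub>with_proj (coupling_graph \<mu> \<nu> \<gamma>)\<^esub> v \<Longrightarrow> v \<rightarrow>\<^sup>*\<^bsub>with_proj (coupling_graph \<mu> \<nu> \<gamma>)\<^esub> u"
  by (rule symmetric_reachable)
    (auto simp: symmetric_def coupling_graph_def intro!: symI)

lemma wf_digraph_coupling_graph: "wf_digraph (with_proj (coupling_graph \<mu> \<nu> \<gamma>))"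
  by unfold_locales (auto simp: coupling_graph_def)

lemma Union_graph_components:
  "\<Union> (graph_components (coupling_graph \<mu> \<nu> \<gamma>)) = set_pmf \<mu> <+> set_pmf \<nu>"
proof -
  interpret wf_digraph "with_proj (coupling_graph \<mu> \<nu> \<gamma>)" by (rule wf_digraph_coupling_graph)
  have "\<Union> sccs_verts = pverts (coupling_graph \<mu> \<nu> \<gamma>)"
  proof (intro equalityI subsetI)
    fix v assume "v \<in> \<Union> sccs_verts"
    then show "v \<in> pverts (coupling_graph \<mu> \<nu> \<gamma>)" using sccs_verts_subsets by auto
  next
    fix v assume "v \<in> pverts (coupling_graph \<mu> \<nu> \<gamma>)"
    then show "v \<in> \<Union> sccs_verts" using scc_of_in_sccs_verts[of v] in_scc_of_self[of v] by auto
  qed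
  then show ?thesis by (simp add: graph_components_def coupling_graph_def)
qed

lemma graph_components_edge:
  assumes "\<gamma> \<in> couplings \<mu> \<nu>" "S \<in> graph_components (coupling_graph \<mu> \<nu> \<gamma>)" "(x, y) \<in> set_pmf \<gamma>"
  shows "Inl x \<in> S \<longleftrightarrow> Inr y \<in> S"
proof -
  interpret wf_digraph "with_proj (coupling_graph \<mu> \<nu> \<gamma>)" by (rule wf_digraph_coupling_graph)
  have "(Inl x, Inr y) \<in> parcs (coupling_graph \<mu> \<nu> \<gamma>)"
    using assms(1,3) set_pmf_coupling(1)[OF assms(1)] by (auto simp: coupling_graph_def pmf_positive)
  then have 1: "Inl x \<rightarrow>\<^sup>*\<^bsub>with_proj (coupling_graph \<mu> \<nu> \<gamma>)\<^esub> Inr y" by auto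
  show ?thesis
    using 1 reachable_coupling_graph_sym[OF 1] assms(2)
    unfolding graph_components_def pre_digraph.sccs_verts_def by blast
qed

text \<open>Equality propagates along a path from \<open>u\<close> to \<open>v\<close>. By symmetry,
  whatever is reachable from \<open>S\<close> is mutually reachable with it, so the path stays in
  \<open>S\<close>; hence \<open>edge\<close> can be confined to \<open>S\<close>, where tightness
  of component potentials is known.\<close>

lemma graph_components_const:
  assumes "S \<in> graph_components (coupling_graph \<mu> \<nu> \<gamma>)" "u \<in> S" "v \<in> S"
    and edge: "\<And>x y. Inl x \<in> S \<Longrightarrow> Inr y \<in> S \<Longrightarrow> (x, y) \<in> set_pmf \<gamma> \<Longrightarrow> g (Inl x) = g (Inr y)"
  shows "g u = g v"
proof -
  let ?G = "with_proj (coupling_graph \<mu> \<nu> \<gamma>)"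
  interpret wf_digraph ?G by (rule wf_digraph_coupling_graph)
  have closed: "z \<in> S" if "y \<in> S" "y \<rightarrow>\<^sup>*\<^bsub>?G\<^esub> z" for y z
    using that reachable_coupling_graph_sym[OF that(2)] assms(1)
    unfolding graph_components_def sccs_verts_def by blast
  have "u \<rightarrow>\<^sup>*\<^bsub>?G\<^esub> v"
    using assms(1-3) unfolding graph_components_def sccs_verts_def by blast
  then have "v \<in> S \<and> g u = g v"
  proof (induction rule: reachable_induct)
    case base
    then show ?case using assms(2) by simp
  next
    case (step y z)
    then have "z \<in> S" using closed by blast
    moreover have "g y = g z"
      using step \<open>z \<in> S\<close> edge by (auto simp: coupling_graph_def set_pmf_iff)
    ultimately show ?case using step by simp
  qed
  then show ?thesis ..
qed

section \<open>Component problems and gluing their optimizers\<close>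

text \<open>The global tight pair serves as the witness for the restricted problem;
  \<open>sub\<close> makes \<open>X\<close> and \<open>Y\<close> the exact supports of the
  conditioned marginals.\<close>

lemma restricted_dual_optimizer_iff_tight:
  assumes fin: "finite (set_pmf \<gamma>)" and \<gamma>: "\<gamma> \<in> couplings \<mu> \<nu>"
    and feas0: "feasible \<mu> \<nu> c \<phi>0 \<psi>0" and tight0: "\<forall>(x, y)\<in>set_pmf \<gamma>. \<phi>0 x + \<psi>0 y = c x y"
    and ne: "set_pmf \<gamma> \<inter> X \<times> Y \<noteq> {}"
    and sep: "\<forall>(x, y)\<in>set_pmf \<gamma>. x \<in> X \<longleftrightarrow> y \<in> Y"
    and sub: "X \<subseteq> set_pmf \<mu>" "Y \<subseteq> set_pmf \<nu>"
  shows "restricted_dual_optimizer X Y \<mu> \<nu> c \<phi> \<psi> \<longleftrightarrow>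
    (\<forall>x\<in>X. \<forall>y\<in>Y. \<phi> x + \<psi> y \<le> c x y) \<and>
    (\<forall>(x, y)\<in>set_pmf \<gamma> \<inter> X \<times> Y. \<phi> x + \<psi> y = c x y)"
proof -
  have "set_pmf \<mu> \<inter> X \<noteq> {}" "set_pmf \<nu> \<inter> Y \<noteq> {}"
    using ne set_pmf_coupling(1)[OF \<gamma>] by blast+
  then have supp: "set_pmf (cond_pmf \<mu> X) = X" "set_pmf (cond_pmf \<nu> Y) = Y"
    using sub by (simp_all add: set_cond_pmf Int_absorb1)
  have supp\<gamma>: "set_pmf (cond_pmf \<gamma> (X \<times> Y)) = set_pmf \<gamma> \<inter> X \<times> Y"
    by (rule set_cond_pmf[OF ne])
  have "restricted_dual_optimizer X Y \<mu> \<nu> c \<phi> \<psi> \<longleftrightarrow>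
      feasible (cond_pmf \<mu> X) (cond_pmf \<nu> Y) c \<phi> \<psi> \<and>
      (\<forall>(x, y)\<in>set_pmf (cond_pmf \<gamma> (X \<times> Y)). \<phi> x + \<psi> y = c x y)"
    unfolding restricted_dual_optimizer_def
  proof (rule dual_optimizer_iff_tight)
    show "finite (set_pmf (cond_pmf \<gamma> (X \<times> Y)))" using fin by (simp add: supp\<gamma>)
    show "cond_pmf \<gamma> (X \<times> Y) \<in> couplings (cond_pmf \<mu> X) (cond_pmf \<nu> Y)"
      using \<gamma> ne sep by (rule cond_pmf_in_couplings)
    show "feasible (cond_pmf \<mu> X) (cond_pmf \<nu> Y) c \<phi>0 \<psi>0"
      using feas0 sub unfolding feasible_def supp by blast
    show "\<forall>(x, y)\<in>set_pmf (cond_pmf \<gamma> (X \<times> Y)). \<phi>0 x + \<psi>0 y = c x y"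
      using tight0 unfolding supp\<gamma> by blast
  qed
  then show ?thesis by (simp only: feasible_def supp supp\<gamma>)
qed

theorem theorem3p9:
  fixes \<mu> \<nu> :: "(real ^ 'd) pmf"
    and c :: "real ^ 'd \<Rightarrow> real ^ 'd \<Rightarrow> real"
    and \<gamma> :: "((real ^ 'd) \<times> (real ^ 'd)) pmf"
    and N :: nat
    and V :: "nat \<Rightarrow> ((real ^ 'd) + (real ^ 'd)) set"
    and X Y :: "nat \<Rightarrow> (real ^ 'd) set"
    and \<phi>\<^sub>C \<psi>\<^sub>C :: "nat \<Rightarrow> real ^ 'd \<Rightarrow> real"
    and \<phi> \<psi> :: "real ^ 'd \<Rightarrow> real"
  assumes "finite (set_pmf \<mu>)" and "finite (set_pmf \<nu>)"
    and "\<And>x y. x \<in> set_pmf \<mu> \<Longrightarrow> y \<in> set_pmf \<nu> \<Longrightarrow> 0 \<le> c x y"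
    and "primal_optimizer \<mu> \<nu> c \<gamma>"
    and "bij_betw V {1..N} (graph_components (coupling_graph \<mu> \<nu> \<gamma>))"
    and "\<And>n. n \<in> {1..N} \<Longrightarrow> V n = X n <+> Y n"
    and "\<And>n. n \<in> {1..N} \<Longrightarrow> X n \<subseteq> set_pmf \<mu> \<and> Y n \<subseteq> set_pmf \<nu>"
    and "\<And>n. n \<in> {1..N} \<Longrightarrow> restricted_dual_optimizer (X n) (Y n) \<mu> \<nu> c (\<phi>\<^sub>C n) (\<psi>\<^sub>C n)"
  shows "dual_optimizer \<mu> \<nu> c \<phi> \<psi> \<longleftrightarrow>
    (\<exists>\<alpha> :: nat \<Rightarrow> real.
      (\<forall>n\<in>{1..N}. \<forall>x\<in>X n.
         \<phi> x = (if n \<noteq> 1 then \<phi>\<^sub>C n x + \<alpha> n + \<alpha> 1 else \<phi>\<^sub>C 1 x + \<alpha> 1)) \<and>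
      (\<forall>n\<in>{1..N}. \<forall>y\<in>Y n.
         \<psi> y = (if n \<noteq> 1 then \<psi>\<^sub>C n y - \<alpha> n - \<alpha> 1 else \<psi>\<^sub>C 1 y - \<alpha> 1)) \<and>
      (\<forall>n\<in>{1..N}. \<forall>m\<in>{1..N}. n \<noteq> m \<longrightarrow>
         - Min {c x y - \<phi>\<^sub>C m x - \<psi>\<^sub>C n y | x y. x \<in> X m \<and> y \<in> Y n}
           \<le> relative_shift \<alpha> n - relative_shift \<alpha> m \<and>
         relative_shift \<alpha> n - relative_shift \<alpha> m
           \<le> Min {c x y - \<phi>\<^sub>C n x - \<psi>\<^sub>C m y | x y. x \<in> X n \<and> y \<in> Y m}))"
    (is "_ \<longleftrightarrow> ?shifted")
proof -
  let ?G = "coupling_graph \<mu> \<nu> \<gamma>"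
  have \<gamma>: "\<gamma> \<in> couplings \<mu> \<nu>" using assms(4) by (simp add: primal_optimizer_def)
  note supp = set_pmf_coupling[OF \<gamma>]
  have fin\<gamma>: "finite (set_pmf \<gamma>)" using supp(1) assms(1,2) by (blast intro: finite_subset)
  obtain \<phi>0 \<psi>0 where pot0: "feasible \<mu> \<nu> c \<phi>0 \<psi>0" "\<forall>(x, y)\<in>set_pmf \<gamma>. \<phi>0 x + \<psi>0 y = c x y"
    using primal_optimizer_imp_potentials[OF assms(1-4)] by blast
  have comp: "V n \<in> graph_components ?G" if "n \<in> {1..N}" for n
    using assms(5) that by (auto simp: bij_betw_def)
  have in_V: "Inl x \<in> V n \<longleftrightarrow> x \<in> X n" "Inr y \<in> V n \<longleftrightarrow> y \<in> Y n" if "n \<in> {1..N}" for n x y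
    using assms(6)[OF that] by auto
  have sep: "\<forall>(x, y)\<in>set_pmf \<gamma>. x \<in> X n \<longleftrightarrow> y \<in> Y n" if "n \<in> {1..N}" for n
    using graph_components_edge[OF \<gamma> comp[OF that]] in_V[OF that] by auto
  have cover: "\<exists>n\<in>{1..N}. v \<in> V n" if "v \<in> set_pmf \<mu> <+> set_pmf \<nu>" for v
    using that assms(5) unfolding Union_graph_components[of \<mu> \<nu> \<gamma>, symmetric] bij_betw_def by auto
  have coverX: "\<exists>n\<in>{1..N}. x \<in> X n" if "x \<in> set_pmf \<mu>" for x
    using cover[OF InlI[OF that]] in_V(1) by blast
  have coverY: "\<exists>n\<in>{1..N}. y \<in> Y n" if "y \<in> set_pmf \<nu>" for y
    using cover[OF InrI[OF that]] in_V(2) by blast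
  \<comment> \<open>A component has a vertex, that vertex has positive mass and so lies on an edge,
    and \<open>sep\<close> keeps the edge inside. Thus both sides of every component are
    nonempty.\<close>
  have meets: "set_pmf \<gamma> \<inter> X n \<times> Y n \<noteq> {}" if n: "n \<in> {1..N}" for n
  proof -
    obtain v where "v \<in> V n"
      using comp[OF n] by (auto simp: graph_components_def pre_digraph.sccs_verts_def)
    then consider x where "x \<in> X n" | y where "y \<in> Y n" using assms(6)[OF n] by auto
    then show ?thesis
    proof cases
      case (1 x)
      then obtain y where "(x, y) \<in> set_pmf \<gamma>" using supp(2) assms(7)[OF n] by blast
      then show ?thesis using 1 sep[OF n] by auto
    next
      case (2 y)
      then obtain x where "(x, y) \<in> set_pmf \<gamma>" using supp(3) assms(7)[OF n] by blast
      then show ?thesis using 2 sep[OF n] by auto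
    qed
  qed
  have optC: "(\<forall>x\<in>X n. \<forall>y\<in>Y n. \<phi>\<^sub>C n x + \<psi>\<^sub>C n y \<le> c x y) \<and>
      (\<forall>(x, y)\<in>set_pmf \<gamma> \<inter> X n \<times> Y n. \<phi>\<^sub>C n x + \<psi>\<^sub>C n y = c x y)" if "n \<in> {1..N}" for n
    using assms(7,8)[OF that]
      restricted_dual_optimizer_iff_tight[OF fin\<gamma> \<gamma> pot0 meets[OF that] sep[OF that]]
    by blast
  have le_Min_iff: "r \<le> Min {c x y - \<phi>\<^sub>C n x - \<psi>\<^sub>C m y | x y. x \<in> X n \<and> y \<in> Y m} \<longleftrightarrow>
      (\<forall>x\<in>X n. \<forall>y\<in>Y m. r \<le> c x y - \<phi>\<^sub>C n x - \<psi>\<^sub>C m y)"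
    if "n \<in> {1..N}" "m \<in> {1..N}" for n m r
  proof -
    let ?S = "(\<lambda>(x, y). c x y - \<phi>\<^sub>C n x - \<psi>\<^sub>C m y) ` (X n \<times> Y m)"
    have S: "{c x y - \<phi>\<^sub>C n x - \<psi>\<^sub>C m y | x y. x \<in> X n \<and> y \<in> Y m} = ?S" by auto
    have "finite (X n)" "finite (Y m)" using that assms(1,2,7) by (blast intro: finite_subset)+
    moreover have "?S \<noteq> {}" using meets[of n] meets[of m] that by blast
    ultimately show ?thesis unfolding S by (subst Min_ge_iff) auto
  qed
  \<comment> \<open>Passage to the absolute shifts \<beta>. The lower bound in the third condition
    is the upper bound with \<open>n\<close> and \<open>m\<close> exchanged, so one family of
    inequalities suffices.\<close>
  have shifted_iff: "?shifted \<longleftrightarrow> (\<exists>\<beta> :: nat \<Rightarrow> real.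
      (\<forall>n\<in>{1..N}. \<forall>x\<in>X n. \<phi> x = \<phi>\<^sub>C n x + \<beta> n) \<and>
      (\<forall>n\<in>{1..N}. \<forall>y\<in>Y n. \<psi> y = \<psi>\<^sub>C n y - \<beta> n) \<and>
      (\<forall>n\<in>{1..N}. \<forall>m\<in>{1..N}. n \<noteq> m \<longrightarrow>
        (\<forall>x\<in>X n. \<forall>y\<in>Y m. \<beta> n - \<beta> m \<le> c x y - \<phi>\<^sub>C n x - \<psi>\<^sub>C m y)))"
    (is "_ \<longleftrightarrow> (\<exists>\<beta>. ?Q \<beta>)")
  proof
    assume ?shifted
    then obtain \<alpha> where \<alpha>:
      "\<forall>n\<in>{1..N}. \<forall>x\<in>X n. \<phi> x = (if n \<noteq> 1 then \<phi>\<^sub>C n x + \<alpha> n + \<alpha> 1 else \<phi>\<^sub>C 1 x + \<alpha> 1)"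
      "\<forall>n\<in>{1..N}. \<forall>y\<in>Y n. \<psi> y = (if n \<noteq> 1 then \<psi>\<^sub>C n y - \<alpha> n - \<alpha> 1 else \<psi>\<^sub>C 1 y - \<alpha> 1)"
      "\<forall>n\<in>{1..N}. \<forall>m\<in>{1..N}. n \<noteq> m \<longrightarrow> relative_shift \<alpha> n - relative_shift \<alpha> m
         \<le> Min {c x y - \<phi>\<^sub>C n x - \<psi>\<^sub>C m y | x y. x \<in> X n \<and> y \<in> Y m}"
      by blast
    have "?Q (\<lambda>n. relative_shift \<alpha> n + \<alpha> 1)"
    proof (intro conjI ballI impI)
      fix n x assume "n \<in> {1..N}" "x \<in> X n"
      then show "\<phi> x = \<phi>\<^sub>C n x + (relative_shift \<alpha> n + \<alpha> 1)"
        by (subst \<alpha>(1)[rule_format]) (auto simp: relative_shift_def)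
    next
      fix n y assume "n \<in> {1..N}" "y \<in> Y n"
      then show "\<psi> y = \<psi>\<^sub>C n y - (relative_shift \<alpha> n + \<alpha> 1)"
        by (subst \<alpha>(2)[rule_format]) (auto simp: relative_shift_def)
    next
      fix n m x y assume *: "n \<in> {1..N}" "m \<in> {1..N}" "n \<noteq> m" "x \<in> X n" "y \<in> Y m"
      then have "relative_shift \<alpha> n - relative_shift \<alpha> m
          \<le> Min {c x y - \<phi>\<^sub>C n x - \<psi>\<^sub>C m y | x y. x \<in> X n \<and> y \<in> Y m}"
        using \<alpha>(3) by blast
      then have "relative_shift \<alpha> n - relative_shift \<alpha> m \<le> c x y - \<phi>\<^sub>C n x - \<psi>\<^sub>C m y"
        unfolding le_Min_iff[OF *(1,2)] using * by blast
      then show "relative_shift \<alpha> n + \<alpha> 1 - (relative_shift \<alpha> m + \<alpha> 1) \<le> c x y - \<phi>\<^sub>C n x - \<psi>\<^sub>C m y"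
        by simp
    qed
    then show "\<exists>\<beta>. ?Q \<beta>" by (rule exI[of ?Q "\<lambda>n. relative_shift \<alpha> n + \<alpha> 1"])
  next
    assume "\<exists>\<beta>. ?Q \<beta>"
    then obtain \<beta> where \<beta>: "?Q \<beta>" by (rule exE)
    \<comment> \<open>Inverse of the substitution
      \<open>\<beta> n = relative_shift \<alpha> n + \<alpha> 1\<close>; the common term cancels in
      differences.\<close>
    define \<alpha> :: "nat \<Rightarrow> real" where "\<alpha> n = (if n = 1 then \<beta> 1 else \<beta> n - \<beta> 1)" for n
    have shift_diff: "relative_shift \<alpha> n - relative_shift \<alpha> m = \<beta> n - \<beta> m" for n m
      by (simp add: relative_shift_def \<alpha>_def)
    have diff_le_Min: "\<beta> n - \<beta> m \<le> Min {c x y - \<phi>\<^sub>C n x - \<psi>\<^sub>C m y | x y. x \<in> X n \<and> y \<in> Y m}"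
      if "n \<in> {1..N}" "m \<in> {1..N}" "n \<noteq> m" for n m
      using \<beta> that by (subst le_Min_iff) auto
    have "- Min {c x y - \<phi>\<^sub>C m x - \<psi>\<^sub>C n y | x y. x \<in> X m \<and> y \<in> Y n} \<le> \<beta> n - \<beta> m"
      if "n \<in> {1..N}" "m \<in> {1..N}" "n \<noteq> m" for n m
      using diff_le_Min[of m n] that by linarith
    moreover have "\<phi> x = (if n \<noteq> 1 then \<phi>\<^sub>C n x + \<alpha> n + \<alpha> 1 else \<phi>\<^sub>C 1 x + \<alpha> 1)"
      if "n \<in> {1..N}" "x \<in> X n" for n x
      using conjunct1[OF \<beta>] that by (auto simp: \<alpha>_def)
    moreover have "\<psi> y = (if n \<noteq> 1 then \<psi>\<^sub>C n y - \<alpha> n - \<alpha> 1 else \<psi>\<^sub>C 1 y - \<alpha> 1)"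
      if "n \<in> {1..N}" "y \<in> Y n" for n y
      using conjunct1[OF conjunct2[OF \<beta>]] that by (auto simp: \<alpha>_def)
    ultimately show ?shifted
      using diff_le_Min by (intro exI[of _ \<alpha>] conjI ballI impI) (simp_all only: shift_diff)
  qed
  show ?thesis unfolding shifted_iff dual_optimizer_iff_tight[OF fin\<gamma> \<gamma> pot0]
  proof
    assume opt: "feasible \<mu> \<nu> c \<phi> \<psi> \<and> (\<forall>(x, y)\<in>set_pmf \<gamma>. \<phi> x + \<psi> y = c x y)"
    have "\<exists>b. (\<forall>x\<in>X n. \<phi> x = \<phi>\<^sub>C n x + b) \<and> (\<forall>y\<in>Y n. \<psi> y = \<psi>\<^sub>C n y - b)"
      if n: "n \<in> {1..N}" for n
    proof -
      \<comment> \<open>The sign is reversed on the second class: subtracting the two tightness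
        equations at an edge then says that \<open>g\<close> agrees at its ends.\<close>
      define g where "g = case_sum (\<lambda>x. \<phi> x - \<phi>\<^sub>C n x) (\<lambda>y. \<psi>\<^sub>C n y - \<psi> y)"
      obtain v where v: "v \<in> V n"
        using comp[OF n] by (auto simp: graph_components_def pre_digraph.sccs_verts_def)
      have g_const: "g u = g v" if "u \<in> V n" for u
      proof (rule graph_components_const[OF comp[OF n] that v])
        fix x y assume "Inl x \<in> V n" "Inr y \<in> V n" "(x, y) \<in> set_pmf \<gamma>"
        then show "g (Inl x) = g (Inr y)"
          using optC[OF n] opt by (force simp: g_def in_V[OF n])
      qed
      have "\<phi> x = \<phi>\<^sub>C n x + g v" if "x \<in> X n" for x
        using g_const[of "Inl x"] that by (simp add: g_def in_V[OF n])
      moreover have "\<psi> y = \<psi>\<^sub>C n y - g v" if "y \<in> Y n" for y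
        using g_const[of "Inr y"] that by (simp add: g_def in_V[OF n])
      ultimately show ?thesis by blast
    qed
    then obtain \<beta> where \<beta>: "\<And>n x. n \<in> {1..N} \<Longrightarrow> x \<in> X n \<Longrightarrow> \<phi> x = \<phi>\<^sub>C n x + \<beta> n"
      "\<And>n y. n \<in> {1..N} \<Longrightarrow> y \<in> Y n \<Longrightarrow> \<psi> y = \<psi>\<^sub>C n y - \<beta> n"
      by metis
    have "\<beta> n - \<beta> m \<le> c x y - \<phi>\<^sub>C n x - \<psi>\<^sub>C m y"
      if "n \<in> {1..N}" "m \<in> {1..N}" "x \<in> X n" "y \<in> Y m" for n m x y
    proof -
      have "\<phi> x + \<psi> y \<le> c x y"
        using opt that assms(7) unfolding feasible_def by blast
      then show ?thesis using \<beta>(1)[of n x] \<beta>(2)[of m y] that by simp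
    qed
    with \<beta> have "?Q \<beta>" by blast
    then show "\<exists>\<beta>. ?Q \<beta>" by (rule exI[of ?Q \<beta>])
  next
    assume "\<exists>\<beta>. ?Q \<beta>"
    then obtain \<beta> where \<beta>: "?Q \<beta>" by (rule exE)
    have "\<phi> x + \<psi> y \<le> c x y" if xy: "x \<in> set_pmf \<mu>" "y \<in> set_pmf \<nu>" for x y
    proof -
      obtain n m where nm: "n \<in> {1..N}" "m \<in> {1..N}" "x \<in> X n" "y \<in> Y m"
        using coverX[OF xy(1)] coverY[OF xy(2)] by blast
      then have *: "\<phi> x = \<phi>\<^sub>C n x + \<beta> n" "\<psi> y = \<psi>\<^sub>C m y - \<beta> m" using \<beta> by blast+
      show ?thesis
      \<comment> \<open>Within one component the shifts cancel, leaving feasibility of the component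
        potentials; across components the constraint is the inequality on \<beta>.\<close>
      proof (cases "n = m")
        case True
        then show ?thesis using * optC[OF nm(1)] nm by fastforce
      next
        case False
        then have "\<beta> n - \<beta> m \<le> c x y - \<phi>\<^sub>C n x - \<psi>\<^sub>C m y" using \<beta> nm by blast
        then show ?thesis using * by simp
      qed
    qed
    moreover have "\<phi> x + \<psi> y = c x y" if xy: "(x, y) \<in> set_pmf \<gamma>" for x y
    proof -
      have "x \<in> set_pmf \<mu>" using supp(1) xy by blast
      then obtain n where n: "n \<in> {1..N}" "x \<in> X n" using coverX by blast
      then have "y \<in> Y n" using sep xy by blast
      then have "\<phi>\<^sub>C n x + \<psi>\<^sub>C n y = c x y" using optC[OF n(1)] n xy by blast
      moreover have "\<phi> x = \<phi>\<^sub>C n x + \<beta> n" "\<psi> y = \<psi>\<^sub>C n y - \<beta> n"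
        using \<beta> n \<open>y \<in> Y n\<close> by blast+
      ultimately show ?thesis by simp
    qed
    ultimately show "feasible \<mu> \<nu> c \<phi> \<psi> \<and> (\<forall>(x, y)\<in>set_pmf \<gamma>. \<phi> x + \<psi> y = c x y)"
      unfolding feasible_def by blast
  qed
qed

end
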